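(* Let $\Sigma=(G,\sigma)$ be a signed graph of order $m+1$ and let $u\in V(\Sigma)$ have degree $d(u)=1$, with unique neighbour $v$ (the edge $uv$ may have either sign). Let $\Sigma'$ be the signed graph obtained from $\Sigma$ by removing $u$ and the edge $uv$. If $(\alpha_1,\dots,\alpha_{m+1})$ and $(\beta_1,\dots,\beta_m)$ are the ordered Laplacian spectra of $\Sigma$ and $\Sigma'$ respectively, then \[ \alpha_p\leqslant\beta_p\leqslant\alpha_{p+1}\quad\text{for } p=1,2,\dots,m. \]
   Context: A signed graph $(G,\sigma)$ consists of a finite simple undirected graph $G$ and a map $\sigma:E(G)\to\{+1,-1\}$. The adjacency matrix has $(l,k)$ entry $\sigma(u_lu_k)$ if $u_l,u_k$ are adjacent and $0$ otherwise; the Laplacian is $L=D-A$ with $D$ the diagonal matrix of unsigned vertex degrees. The ordered spectrum is the list of eigenvalues with multiplicity in non-decreasing order. Deleting a vertex keeps the signs of the remaining edges. *)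

theory Defs
  imports
    "HOL-Computational_Algebra.Polynomial"
    "HOL-Library.Multiset"
    "Jordan_Normal_Form.Char_Poly"
begin

text \<open>
  Edges are two-element sets of vertices. The values of \<open>edge_sign\<close> outside \<open>edges\<close> are irrelevant.
\<close>

record 'a signed_graph =
  vertices :: "'a set"
  edges :: "'a set set"
  edge_sign :: "'a set \<Rightarrow> real"

definition wf_signed_graph :: "'a signed_graph \<Rightarrow> bool" where
  "wf_signed_graph G \<longleftrightarrow>
     finite (vertices G) \<and>
     (\<forall>e\<in>edges G. e \<subseteq> vertices G \<and> card e = 2) \<and>
     (\<forall>e\<in>edges G. edge_sign G e \<in> {1, -1})"

definition degree_of :: "'a signed_graph \<Rightarrow> 'a \<Rightarrow> nat" where
  "degree_of G x = card {e \<in> edges G. x \<in> e}"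

definition delete_vertex :: "'a signed_graph \<Rightarrow> 'a \<Rightarrow> 'a signed_graph" where
  "delete_vertex G x =
     \<lparr>vertices = vertices G - {x}, edges = {e \<in> edges G. x \<notin> e}, edge_sign = edge_sign G\<rparr>"

text \<open>
  The matrices of a signed graph are taken with respect to a labelling
  of its vertices, given as a list containing each vertex exactly once.
\<close>

definition vertex_labelling :: "'a signed_graph \<Rightarrow> 'a list \<Rightarrow> bool" where
  "vertex_labelling G us \<longleftrightarrow> distinct us \<and> set us = vertices G"

definition adjacency_matrix :: "'a signed_graph \<Rightarrow> 'a list \<Rightarrow> real mat" where
  "adjacency_matrix G us = mat (length us) (length us)
     (\<lambda>(l, k). if {us ! l, us ! k} \<in> edges G then edge_sign G {us ! l, us ! k} else 0)"

definition degree_matrix :: "'a signed_graph \<Rightarrow> 'a list \<Rightarrow> real mat" where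
  "degree_matrix G us = mat_diag (length us) (\<lambda>l. real (degree_of G (us ! l)))"

definition laplacian_matrix :: "'a signed_graph \<Rightarrow> 'a list \<Rightarrow> real mat" where
  "laplacian_matrix G us = degree_matrix G us - adjacency_matrix G us"

text \<open>
  The eigenvalues are the roots of the characteristic polynomial, listed with multiplicity in
  non-decreasing order. Only real eigenvalues are recorded, so the list has full length
  exactly when all eigenvalues of the matrix are real.
\<close>

definition ordered_spectrum :: "real mat \<Rightarrow> real list" where
  "ordered_spectrum A = sorted_list_of_multiset (proots (char_poly A))"

end

theory Submission
  imports Defs "Jordan_Normal_Form.Schur_Decomposition"
begin

text \<open>
  Summing over ordered pairs of adjacent vertices shows that the quadratic form of the Laplacian is
  half the sum of the squares $(f(a) - \sigma(ab) f(b))^2$. It is therefore nonnegative, and deleting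
  the pendant vertex $u$ removes exactly the term $(f(u) - \sigma(uv) f(v))^2$. Extending $f$ by
  $f(u) = \sigma(uv) f(v)$ preserves the form and does not decrease the norm; as the eigenvalues of
  the smaller graph are nonnegative, this yields $\alpha_p \le \beta_p$. Conversely, restricting to the
  hyperplane $f(u) = 0$ preserves the norm and does not increase the form, which costs one dimension
  and yields $\beta_p \le \alpha_{p+1}$. Both are instances of a Courant--Fischer comparison along
  a linear map.
\<close>

section \<open>Diagonalisation and ordered spectrum of real symmetric matrices\<close>

lemma symmetric_char_poly_splits:
  fixes A :: "real mat"
  assumes A: "A \<in> carrier_mat n n" and sym: "transpose_mat A = A"
  shows "\<exists>es. char_poly A = (\<Prod>e\<leftarrow>es. [:- e, 1:])"
proof -
  interpret hp: map_poly_inj_comm_ring_hom complex_of_real ..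
  let ?B = "map_mat complex_of_real A"
  have B: "?B \<in> carrier_mat n n" using A by simp
  obtain as where as: "char_poly ?B = (\<Prod>a\<leftarrow>as. [:- a, 1:])"
    using char_poly_factorized[OF B] by blast
  have real: "complex_of_real (Re a) = a" if "a \<in> set as" for a
  proof -
    have "poly (char_poly ?B) a = 0"
      unfolding as using that by (auto simp: poly_prod_list prod_list_zero_iff)
    then have "eigenvalue ?B a"
      using eigenvalue_root_char_poly[OF B] by simp
    then obtain x where x: "x \<in> carrier_vec n" "x \<noteq> 0\<^sub>v n" and ev: "?B *\<^sub>v x = a \<cdot>\<^sub>v x"
      using B unfolding eigenvalue_def eigenvector_def by auto
    have ev': "(\<Sum>j<n. complex_of_real (A $$ (i,j)) * x $ j) = a * x $ i" if "i < n" for i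
      using arg_cong[OF ev, of "\<lambda>y. y $ i"] that A x(1)
      by (simp add: scalar_prod_def atLeast0LessThan)
    let ?N = "\<Sum>i<n. cnj (x $ i) * x $ i"
    let ?S = "\<Sum>i<n. \<Sum>j<n. cnj (x $ i) * (complex_of_real (A $$ (i,j)) * x $ j)"
    have A_sym: "A $$ (i,j) = A $$ (j,i)" if "i < n" "j < n" for i j
      using A that arg_cong[OF sym, of "\<lambda>M. M $$ (i,j)"] by simp
    have S: "?S = a * ?N"
      by (simp add: sum_distrib_left[symmetric] ev')
        (simp add: sum_distrib_left mult_ac)
    \<comment> \<open>Conjugation exchanges the roles of \<open>i\<close> and \<open>j\<close>;
      symmetry of \<open>A\<close> and swapping the two sums restore \<open>?S\<close>.\<close>
    have "cnj ?S = (\<Sum>i<n. \<Sum>j<n. cnj (x $ j) * (complex_of_real (A $$ (j,i)) * x $ i))"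
      by (simp, intro sum.cong refl) (simp add: A_sym mult_ac)
    also have "\<dots> = ?S" by (rule sum.swap)
    finally have "cnj a * cnj ?N = a * ?N" unfolding S by simp
    moreover have "cnj ?N = ?N" by (simp add: mult.commute)
    moreover have N: "?N = complex_of_real (\<Sum>i<n. (cmod (x $ i))\<^sup>2)"
      by (simp add: mult.commute complex_norm_square[symmetric] del: complex_mult_cnj)
    obtain i where "i < n" "x $ i \<noteq> 0" using x by (metis eq_vecI carrier_vecD index_zero_vec)
    then have "(\<Sum>i<n. (cmod (x $ i))\<^sup>2) > 0"
      by (intro sum_pos2[of _ i]) auto
    then have "?N \<noteq> 0" unfolding N by (metis of_real_eq_0_iff less_irrefl)
    ultimately have "cnj a = a" by simp
    then show ?thesis by (simp add: complex_eq_iff)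
  qed
  have "map_poly complex_of_real (char_poly A) = (\<Prod>a\<leftarrow>as. [:- a, 1:])"
    using of_real_hom.char_poly_hom[OF A, where 'a = complex] as by simp
  also have "\<dots> = map_poly complex_of_real (\<Prod>e\<leftarrow>map Re as. [:- e, 1:])"
    unfolding hp.hom_prod_list map_map
    by (intro arg_cong[of _ _ prod_list] map_cong refl) (simp add: real)
  finally have "char_poly A = (\<Prod>e\<leftarrow>map Re as. [:- e, 1:])" by (simp only: hp.eq_iff)
  then show ?thesis by blast
qed

text \<open>
  The witness is the reflection along \<open>w = v - e\<^sub>0\<close>. If \<open>v = e\<^sub>0\<close>, then \<open>c = 2 / 0 = 0\<close> and the
  formula gives the identity.
\<close>

lemma householder_reflection:
  fixes v :: "real vec"
  assumes v: "v \<in> carrier_vec n" and n: "0 < n" and norm: "v \<bullet> v = 1"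
  obtains H where "H \<in> carrier_mat n n" "transpose_mat H = H" "H * H = 1\<^sub>m n"
    "H *\<^sub>v unit_vec n 0 = v"
proof
  define w where "w = v - unit_vec n 0"
  define c where "c = 2 / (w \<bullet> w)"
  define H where "H = mat n n (\<lambda>(i,j). (if i = j then 1 else 0) - c * w $ i * w $ j)"
  have w: "w \<in> carrier_vec n" using v by (simp add: w_def)
  have ww: "w \<bullet> w = (\<Sum>k<n. w $ k * w $ k)" 
    using w by (simp add: scalar_prod_def atLeast0LessThan)
  \<comment> \<open>This makes the rank-one terms of \<open>H * H\<close> cancel. It also holds for
    \<open>w \<bullet> w = 0\<close>, where both sides are 0.\<close>
  have c: "c * c * (w \<bullet> w) = 2 * c" by (simp add: c_def)
  show H: "H \<in> carrier_mat n n" by (simp add: H_def)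
  show "transpose_mat H = H" by (rule eq_matI) (auto simp: H_def)
  show "H * H = 1\<^sub>m n"
  proof (rule eq_matI)
    fix i j assume "i < dim_row (1\<^sub>m n)" "j < dim_col (1\<^sub>m n)"
    then have ij: "i < n" "j < n" by auto
    have "(H * H) $$ (i,j) = (\<Sum>k<n. ((if i = k then 1 else 0) - c * w $ i * w $ k) *
        ((if k = j then 1 else 0) - c * w $ k * w $ j))"
      using ij by (simp add: H_def scalar_prod_def atLeast0LessThan)
    also have "\<dots> = (\<Sum>k<n. (if k = i then (if i = j then 1 else 0) - c * w $ i * w $ j else 0)
        - (if k = j then c * w $ i * w $ j else 0) + (c * c * w $ i * w $ j) * (w $ k * w $ k))"
      by (rule sum.cong) (auto simp: algebra_simps)
    also have "\<dots> = (if i = j then 1 else 0) - 2 * c * w $ i * w $ j + (c * c * (w \<bullet> w)) * w $ i * w $ j"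
      using ij by (simp add: sum.distrib sum_subtractf ww)
        (simp add: sum_distrib_left mult_ac)
    finally show "(H * H) $$ (i,j) = 1\<^sub>m n $$ (i,j)" using ij by (simp add: c)
  qed (use H in auto)
  show "H *\<^sub>v unit_vec n 0 = v"
  proof (rule eq_vecI)
    fix i assume "i < dim_vec v"
    then have i: "i < n" using v by simp
    \<comment> \<open>Since \<open>v\<close> is a unit vector, \<open>w \<bullet> w\<close> is twice
      \<open>1 - v $ 0\<close>. Hence \<open>c * w $ 0 = -1\<close> unless \<open>w\<close> is zero,
      so the reflection adds exactly \<open>w\<close> to the first unit vector.\<close>
    have v0: "w \<bullet> w = - 2 * w $ 0"
    proof -
      have "w \<bullet> w = v \<bullet> v - 2 * v $ 0 + 1"
        using v n unfolding w_def
        by (simp add: minus_scalar_prod_distrib[of _ n] scalar_prod_minus_distrib[of _ n])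
      then show ?thesis using norm n v by (simp add: w_def)
    qed
    have w_zero: "w $ i = 0" if "w \<bullet> w = 0"
    proof -
      have "\<forall>k\<in>{..<n}. w $ k * w $ k = 0"
        using that unfolding ww by (subst (asm) sum_nonneg_eq_0_iff) auto
      then show ?thesis using i by simp
    qed
    have "(H *\<^sub>v unit_vec n 0) $ i = H $$ (i, 0)"
      using i n H by (simp add: row_def)
    also have "\<dots> = (if i = 0 then 1 else 0) - c * w $ i * w $ 0"
      using i n by (simp add: H_def)
    also have "\<dots> = (if i = 0 then 1 else 0) + w $ i"
      using w_zero v0 by (cases "w \<bullet> w = 0") (auto simp: c_def)
    also have "\<dots> = v $ i" using i v n by (simp add: w_def)
    finally show "(H *\<^sub>v unit_vec n 0) $ i = v $ i" .
  qed (use v H in auto)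
qed

lemma mult_block_diag_mat:
  assumes "A \<in> carrier_mat n n" "B \<in> carrier_mat m m" "C \<in> carrier_mat n n" "D \<in> carrier_mat m m"
  shows "four_block_mat A (0\<^sub>m n m) (0\<^sub>m m n) B * four_block_mat C (0\<^sub>m n m) (0\<^sub>m m n) D
    = four_block_mat (A * C) (0\<^sub>m n m) (0\<^sub>m m n) (B * D)"
  using assms by (subst mult_four_block_mat[of _ n n _ m _ m _ _ n _ m]) auto

text \<open>Deflation, by induction on the list of roots. Conjugating with a reflection that carries
  the first unit vector to a unit eigenvector for \<open>e\<close> splits off a 1-by-1 block, and
  the remaining symmetric block has the remaining roots. The list \<open>es\<close> is arbitrary, so
  the eigenvalues appear on the diagonal in any prescribed order; the sorted order is used
  later.\<close>

lemma symmetric_spectral_decomposition: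
  fixes A :: "real mat"
  assumes "A \<in> carrier_mat n n" "transpose_mat A = A"
    and "char_poly A = (\<Prod>e\<leftarrow>es. [:- e, 1:])"
  shows "\<exists>U\<in>carrier_mat n n. transpose_mat U * U = 1\<^sub>m n \<and>
    A = U * mat_diag n (\<lambda>i. es ! i) * transpose_mat U"
  using assms
proof (induction es arbitrary: n A)
  case Nil
  then have "n = 0" using degree_monic_char_poly[of A n] by simp
  then show ?case using Nil by (intro bexI[of _ "1\<^sub>m 0"]) auto
next
  case (Cons e es)
  note A = Cons.prems(1) and sym = Cons.prems(2) and cp = Cons.prems(3)
  define k where "k = length es"
  have n: "n = Suc k"
    using degree_monic_char_poly[OF A] degree_linear_factors[of uminus "e # es"] cp
    by (simp add: k_def)
  have "eigenvalue A e" using eigenvalue_root_char_poly[OF A] cp by simp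
  then obtain x where x: "x \<in> carrier_vec n" "x \<noteq> 0\<^sub>v n" and ev: "A *\<^sub>v x = e \<cdot>\<^sub>v x"
    using A unfolding eigenvalue_def eigenvector_def by auto
  define v where "v = (1 / sqrt (x \<bullet> x)) \<cdot>\<^sub>v x"
  have "x \<bullet> x > 0" using conjugate_square_greater_0_vec[OF x(1)] x(2) by simp
  then have norm: "v \<bullet> v = 1" using x(1) by (simp add: v_def)
  have v: "v \<in> carrier_vec n" using x by (simp add: v_def)
  have Av: "A *\<^sub>v v = e \<cdot>\<^sub>v v"
    using A x ev by (simp add: v_def mult_mat_vec smult_smult_assoc mult.commute)
  obtain H where H: "H \<in> carrier_mat n n" and Hsym: "transpose_mat H = H"
    and HH: "H * H = 1\<^sub>m n" and Hv: "H *\<^sub>v unit_vec n 0 = v"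
    using householder_reflection[OF v _ norm] n by auto
  define M where "M = H * A * H"
  have M: "M \<in> carrier_mat n n" using H A by (simp add: M_def)
  have Msym: "transpose_mat M = M"
    using H A by (simp add: M_def transpose_mult[of _ n n _ n] Hsym sym assoc_mult_mat[of _ n n _ n _ n])
  have Me: "M *\<^sub>v unit_vec n 0 = e \<cdot>\<^sub>v unit_vec n 0"
  proof -
    have "H *\<^sub>v v = unit_vec n 0"
      using Hv HH H by (metis assoc_mult_mat_vec one_mult_mat_vec unit_vec_carrier)
    moreover have "M *\<^sub>v unit_vec n 0 = H *\<^sub>v (A *\<^sub>v (H *\<^sub>v unit_vec n 0))"
      using H A by (simp add: M_def assoc_mult_mat_vec[of _ n n _ n])
    ultimately show ?thesis using Hv Av mult_mat_vec[OF H v] by simp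
  qed
  \<comment> \<open>The eigenvector equation determines the first column of \<open>M\<close>, and
    symmetry then determines the first row.\<close>
  have M0: "M $$ (i, 0) = (if i = 0 then e else 0)" if "i < n" for i
    using arg_cong[OF Me, of "\<lambda>y. y $ i"] that M n by (simp add: row_def)
  have M0': "M $$ (0, i) = (if i = 0 then e else 0)" if "i < n" for i
    using M0[OF that] arg_cong[OF Msym, of "\<lambda>N. N $$ (i, 0)"] that M n by simp
  define E where "E = mat 1 1 (\<lambda>_. e)"
  define A' where "A' = mat k k (\<lambda>(i,j). M $$ (Suc i, Suc j))"
  have E: "E \<in> carrier_mat 1 1" and A': "A' \<in> carrier_mat k k"
    by (auto simp: E_def A'_def)
  have Mblock: "M = four_block_mat E (0\<^sub>m 1 k) (0\<^sub>m k 1) A'"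
  proof (rule eq_matI)
    fix i j assume "i < dim_row (four_block_mat E (0\<^sub>m 1 k) (0\<^sub>m k 1) A')"
      "j < dim_col (four_block_mat E (0\<^sub>m 1 k) (0\<^sub>m k 1) A')"
    then have "i < n" "j < n" using E A' n by auto
    then show "M $$ (i,j) = four_block_mat E (0\<^sub>m 1 k) (0\<^sub>m k 1) A' $$ (i,j)"
      using M0[of i] M0'[of j] n by (cases i; cases j) (auto simp: E_def A'_def)
  qed (use M E A' n in auto)
  have A'sym: "transpose_mat A' = A'"
  proof (rule eq_matI)
    fix i j assume "i < dim_row A'" "j < dim_col A'"
    then have "i < k" "j < k" using A' by auto
    then show "transpose_mat A' $$ (i,j) = A' $$ (i,j)"
      using arg_cong[OF Msym, of "\<lambda>N. N $$ (Suc i, Suc j)"] M n by (simp add: A'_def)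
  qed (use A' in auto)
  \<comment> \<open>\<open>H\<close> is its own inverse, so conjugation by \<open>H\<close> is a
    similarity.\<close>
  have "similar_mat A M"
    by (rule similar_matI[of _ _ H H n])
      (use H A M HH in \<open>auto simp: M_def assoc_mult_mat[of _ n n _ n _ n]
        assoc_mult_mat[of H n n H n _ n, symmetric]\<close>)
  then have "char_poly A = char_poly M" by (rule char_poly_similar)
  also have "\<dots> = char_poly E * char_poly A'"
  proof (rule char_poly_0_block[OF Mblock _ symmetric_char_poly_splits[OF A' A'sym] E _ A'])
    have "char_poly E = (\<Prod>e\<leftarrow>diag_mat E. [:- e, 1:])"
      by (rule char_poly_upper_triangular[OF E]) (simp add: E_def upper_triangular_def)
    then show "\<exists>es. char_poly E = (\<Prod>e\<leftarrow>es. [:- e, 1:])" by blast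
  qed simp
  also have "char_poly E = [:- e, 1:]"
    by (subst char_poly_upper_triangular[OF E]) (auto simp: E_def upper_triangular_def diag_mat_def)
  finally have "[:- e, 1:] * (\<Prod>e\<leftarrow>es. [:- e, 1:]) = [:- e, 1:] * char_poly A'"
    unfolding cp by (simp only: list.map prod_list.Cons)
  then have "char_poly A' = (\<Prod>e\<leftarrow>es. [:- e, 1:])"
    by (simp only: mult_cancel_left) simp
  from Cons.IH[OF A' A'sym this] obtain U' where U': "U' \<in> carrier_mat k k"
    and orth: "transpose_mat U' * U' = 1\<^sub>m k"
    and dec: "A' = U' * mat_diag k (\<lambda>i. es ! i) * transpose_mat U'" by auto
  \<comment> \<open>Bordering \<open>U'\<close> by a 1 diagonalises \<open>M\<close>; undoing the
    conjugation gives \<open>H * V\<close> as the orthogonal matrix for \<open>A\<close>.\<close>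
  define V where "V = four_block_mat (1\<^sub>m 1) (0\<^sub>m 1 k) (0\<^sub>m k 1) U'"
  have V: "V \<in> carrier_mat n n"
    unfolding V_def n using four_block_carrier_mat[OF one_carrier_mat[of 1] U'] by simp
  have VT: "transpose_mat V = four_block_mat (1\<^sub>m 1) (0\<^sub>m 1 k) (0\<^sub>m k 1) (transpose_mat U')"
    unfolding V_def using U'
    by (subst transpose_four_block_mat[of _ 1 1 _ k _ k]) auto
  have VV: "transpose_mat V * V = 1\<^sub>m n"
  proof -
    have "transpose_mat V * V = four_block_mat (1\<^sub>m 1) (0\<^sub>m 1 k) (0\<^sub>m k 1) (1\<^sub>m k)"
      unfolding VT unfolding V_def using U' orth by (subst mult_block_diag_mat) auto
    then show ?thesis by (simp add: four_block_one_mat n)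
  qed
  let ?D = "mat_diag n (\<lambda>i. (e # es) ! i)"
  have D: "?D = four_block_mat E (0\<^sub>m 1 k) (0\<^sub>m k 1) (mat_diag k (\<lambda>i. es ! i))"
    by (rule eq_matI) (auto simp: E_def mat_diag_def n nth_Cons')
  have Dc: "?D \<in> carrier_mat n n" by simp
  have VDV: "M = V * ?D * transpose_mat V"
  proof -
    have d: "mat_diag k (\<lambda>i. es ! i) \<in> carrier_mat k k" by simp
    have "V * ?D = four_block_mat E (0\<^sub>m 1 k) (0\<^sub>m k 1) (U' * mat_diag k (\<lambda>i. es ! i))"
      unfolding V_def D using mult_block_diag_mat[OF one_carrier_mat U' E d] E by simp
    then have "V * ?D * transpose_mat V = four_block_mat E (0\<^sub>m 1 k) (0\<^sub>m k 1) A'"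
      unfolding VT dec using mult_block_diag_mat[OF E mult_carrier_mat[OF U' d] one_carrier_mat]
        U' E by simp
    then show ?thesis by (simp add: Mblock)
  qed
  note [simp] = assoc_mult_mat[of _ n n _ n _ n] mult_carrier_mat[of _ n n _ n]
  show ?case
  proof (intro bexI[of _ "H * V"] conjI)
    have UT: "transpose_mat (H * V) = transpose_mat V * H"
      using H V by (simp add: transpose_mult[of _ n n _ n] Hsym)
    have "transpose_mat (H * V) * (H * V) = transpose_mat V * ((H * H) * V)"
      unfolding UT using H V by simp
    then show "transpose_mat (H * V) * (H * V) = 1\<^sub>m n" using HH VV V by simp
    have "A = (H * H) * A * (H * H)" using A HH by simp
    also have "\<dots> = H * M * H" using A H by (simp add: M_def)
    also have "\<dots> = H * V * ?D * transpose_mat (H * V)"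
      unfolding VDV UT using H V Dc by simp
    finally show "A = H * V * ?D * transpose_mat (H * V)" .
    show "H * V \<in> carrier_mat n n" using H V by simp
  qed
qed

text \<open>In coordinates \<open>y\<close> with respect to an orthonormal eigenbasis, the norm and
  the quadratic form both become diagonal sums. Rayleigh quotients can then be bounded term by
  term.\<close>

lemma symmetric_principal_axes:
  fixes A :: "real mat"
  assumes A: "A \<in> carrier_mat n n" and sym: "transpose_mat A = A"
    and cp: "char_poly A = (\<Prod>e\<leftarrow>es. [:- e, 1:])"
  shows "\<exists>U\<in>carrier_mat n n. transpose_mat U * U = 1\<^sub>m n \<and> U * transpose_mat U = 1\<^sub>m n \<and>
    (\<forall>y\<in>carrier_vec n. (U *\<^sub>v y) \<bullet> (U *\<^sub>v y) = (\<Sum>i<n. (y $ i)\<^sup>2) \<and>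
      (U *\<^sub>v y) \<bullet> (A *\<^sub>v (U *\<^sub>v y)) = (\<Sum>i<n. es ! i * (y $ i)\<^sup>2))"
proof -
  obtain U where U: "U \<in> carrier_mat n n" and orth: "transpose_mat U * U = 1\<^sub>m n"
    and dec: "A = U * mat_diag n (\<lambda>i. es ! i) * transpose_mat U"
    using symmetric_spectral_decomposition[OF A sym cp] by auto
  let ?D = "mat_diag n (\<lambda>i. es ! i)"
  have UT: "transpose_mat U \<in> carrier_mat n n" using U by simp
  have D: "?D \<in> carrier_mat n n" by simp
  have inv: "transpose_mat U *\<^sub>v (U *\<^sub>v y) = y" if "y \<in> carrier_vec n" for y
    using that U UT orth by (metis assoc_mult_mat_vec one_mult_mat_vec)
  have form: "(U *\<^sub>v y) \<bullet> (U *\<^sub>v z) = y \<bullet> z" if "y \<in> carrier_vec n" "z \<in> carrier_vec n" for y z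
    using transpose_vec_mult_scalar[OF U that(2), of "U *\<^sub>v y"] U that inv by simp
  show ?thesis
  proof (intro bexI[of _ U] conjI ballI)
    show "U \<in> carrier_mat n n" "transpose_mat U * U = 1\<^sub>m n" by fact+
    show "U * transpose_mat U = 1\<^sub>m n" using mat_mult_left_right_inverse[OF UT U orth] .
    fix y :: "real vec" assume y: "y \<in> carrier_vec n"
    show "(U *\<^sub>v y) \<bullet> (U *\<^sub>v y) = (\<Sum>i<n. (y $ i)\<^sup>2)"
      using y by (simp only: form) (simp add: scalar_prod_def atLeast0LessThan power2_eq_square)
    have "A *\<^sub>v (U *\<^sub>v y) = U *\<^sub>v (?D *\<^sub>v y)"
    proof -
      have "A *\<^sub>v (U *\<^sub>v y) = U *\<^sub>v (?D *\<^sub>v (transpose_mat U *\<^sub>v (U *\<^sub>v y)))"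
        unfolding dec using U UT D y by (simp add: assoc_mult_mat_vec[of _ n n _ n])
      then show ?thesis using inv[OF y] by simp
    qed
    moreover have "?D *\<^sub>v y = vec n (\<lambda>i. es ! i * y $ i)"
    proof (rule eq_vecI)
      fix i assume "i < dim_vec (vec n (\<lambda>i. es ! i * y $ i))"
      then have i: "i < n" by simp
      have "(?D *\<^sub>v y) $ i = (\<Sum>j<n. (if i = j then es ! j else 0) * y $ j)"
        using i y by (simp add: mat_diag_def scalar_prod_def atLeast0LessThan)
      also have "\<dots> = (\<Sum>j<n. if i = j then es ! i * y $ j else 0)"
        by (rule sum.cong) auto
      finally show "(?D *\<^sub>v y) $ i = vec n (\<lambda>i. es ! i * y $ i) $ i" using i by simp
    qed (simp add: mat_diag_def)
    ultimately show "(U *\<^sub>v y) \<bullet> (A *\<^sub>v (U *\<^sub>v y)) = (\<Sum>i<n. es ! i * (y $ i)\<^sup>2)"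
      using y by (simp add: form del: assoc_mult_mat_vec) (simp add: scalar_prod_def atLeast0LessThan power2_eq_square mult_ac)
  qed
qed

text \<open>\<open>ordered_spectrum\<close> records real roots only; because the characteristic
  polynomial splits over the reals, none is lost. The last fact lets the principal axes be taken in
  increasing order of eigenvalue.\<close>

lemma ordered_spectrum_symmetric:
  assumes A: "A \<in> carrier_mat n n" and sym: "transpose_mat A = A"
  shows "length (ordered_spectrum A) = n" "sorted (ordered_spectrum A)"
    "char_poly A = (\<Prod>e\<leftarrow>ordered_spectrum A. [:- e, 1:])"
proof -
  obtain es where es: "char_poly A = (\<Prod>e\<leftarrow>es. [:- e, 1:])"
    using symmetric_char_poly_splits[OF A sym] by blast
  have "proots (\<Prod>e\<leftarrow>es. [:- e, 1:]) = mset es"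
  proof (induction es)
    case (Cons a es)
    have "(\<Prod>e\<leftarrow>es. [:- e, 1:]) \<noteq> 0" by (auto simp: prod_list_zero_iff)
    then have "proots ([:- a, 1:] * (\<Prod>e\<leftarrow>es. [:- e, 1:])) = add_mset a (mset es)"
      using Cons.IH by (subst proots_mult) auto
    then show ?case by (simp only: list.map prod_list.Cons mset.simps)
  qed simp
  then have spec: "ordered_spectrum A = sort es"
    by (simp add: ordered_spectrum_def es)
  have "length es = n"
    using degree_monic_char_poly[OF A] degree_linear_factors[of uminus es] es by simp
  then show "length (ordered_spectrum A) = n" by (simp add: spec)
  show "sorted (ordered_spectrum A)" by (simp add: spec)
  have "mset (map (\<lambda>e. [:- e, 1:]) (sort es)) = mset (map (\<lambda>e. [:- e, 1:]) es)" by simp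
  then show "char_poly A = (\<Prod>e\<leftarrow>ordered_spectrum A. [:- e, 1:])"
    unfolding es spec by (metis prod_mset_prod_list)
qed

section \<open>Courant--Fischer comparison of two spectra\<close>

text \<open>Padding with zero rows gives a square matrix. Its transpose kills the unit vector of a
  padded row, so the determinant vanishes and the kernel is nontrivial.\<close>

lemma wide_matrix_kernel:
  fixes M :: "'a :: field mat"
  assumes M: "M \<in> carrier_mat r n" and "r < n"
  obtains y where "y \<in> carrier_vec n" "y \<noteq> 0\<^sub>v n" "M *\<^sub>v y = 0\<^sub>v r"
proof -
  define N where "N = mat n n (\<lambda>(i,j). if i < r then M $$ (i,j) else 0)"
  have N: "N \<in> carrier_mat n n" by (simp add: N_def)
  have "transpose_mat N *\<^sub>v unit_vec n r = 0\<^sub>v n"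
    using \<open>r < n\<close> N by (intro eq_vecI) (auto simp: N_def)
  moreover have "unit_vec n r \<noteq> (0\<^sub>v n :: 'a vec)"
    using \<open>r < n\<close> by (metis index_unit_vec(1) index_zero_vec(1) one_neq_zero)
  ultimately have "det (transpose_mat N) = 0"
    using iffD2[OF det_0_iff_vec_prod_zero_field[of "transpose_mat N" n] exI[of _ "unit_vec n r"]] N
    by simp
  then have "det N = 0" using det_transpose[OF N] by simp
  then obtain y where y: "y \<in> carrier_vec n" "y \<noteq> 0\<^sub>v n" and Ny: "N *\<^sub>v y = 0\<^sub>v n"
    using det_0_iff_vec_prod_zero_field[OF N] by blast
  have "M *\<^sub>v y = 0\<^sub>v r"
  proof (rule eq_vecI)
    fix i assume "i < dim_vec (0\<^sub>v r)"
    then have i: "i < r" by simp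
    have "row M i = row N i"
      using i \<open>r < n\<close> M by (intro eq_vecI) (auto simp: N_def)
    then show "(M *\<^sub>v y) $ i = 0\<^sub>v r $ i"
      using arg_cong[OF Ny, of "\<lambda>z. z $ i"] i M N \<open>r < n\<close> by simp
  qed (use M in simp)
  with y show thesis by (rule that)
qed

lemma mult_mat_zero_vec:
  assumes "A \<in> carrier_mat m n"
  shows "A *\<^sub>v 0\<^sub>v n = 0\<^sub>v m"
  using assms by (intro eq_vecI) auto

text \<open>
  The Courant--Fischer dimension count: on the span of the first $p + r + 1$ eigenvectors of $A$, the
  $r$ equations $C x = 0$ and the $p$ equations saying that $T x$ is orthogonal to the first $p$
  eigenvectors of $B$ have a common nonzero solution. Indices start at $0$.
\<close>

lemma spectrum_comparison:
  fixes A B C T :: "real mat"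
  defines "\<alpha> \<equiv> ordered_spectrum A" and "\<beta> \<equiv> ordered_spectrum B"
  assumes A: "A \<in> carrier_mat n n" "transpose_mat A = A"
    and B: "B \<in> carrier_mat k k" "transpose_mat B = B"
    and C: "C \<in> carrier_mat r n" and T: "T \<in> carrier_mat k n"
    and pk: "p < k" and pr: "p + r < n"
    and comp: "\<And>x. x \<in> carrier_vec n \<Longrightarrow> x \<noteq> 0\<^sub>v n \<Longrightarrow> C *\<^sub>v x = 0\<^sub>v r \<Longrightarrow>
      x \<bullet> (A *\<^sub>v x) \<le> \<alpha> ! (p + r) * (x \<bullet> x) \<Longrightarrow>
      T *\<^sub>v x \<noteq> 0\<^sub>v k \<and>
      (T *\<^sub>v x) \<bullet> (B *\<^sub>v (T *\<^sub>v x)) \<le> \<alpha> ! (p + r) * ((T *\<^sub>v x) \<bullet> (T *\<^sub>v x))"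
  shows "\<beta> ! p \<le> \<alpha> ! (p + r)"
proof -
  note specA = ordered_spectrum_symmetric[OF A, folded \<alpha>_def]
    and specB = ordered_spectrum_symmetric[OF B, folded \<beta>_def]
  obtain U where U: "U \<in> carrier_mat n n" and UU: "transpose_mat U * U = 1\<^sub>m n" and "U * transpose_mat U = 1\<^sub>m n"
    and normU: "\<And>y. y \<in> carrier_vec n \<Longrightarrow> (U *\<^sub>v y) \<bullet> (U *\<^sub>v y) = (\<Sum>i<n. (y $ i)\<^sup>2)"
    and formU: "\<And>y. y \<in> carrier_vec n \<Longrightarrow>
      (U *\<^sub>v y) \<bullet> (A *\<^sub>v (U *\<^sub>v y)) = (\<Sum>i<n. \<alpha> ! i * (y $ i)\<^sup>2)"
    using symmetric_principal_axes[OF A specA(3)] by blast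
  obtain W where W: "W \<in> carrier_mat k k" and "transpose_mat W * W = 1\<^sub>m k" and WW: "W * transpose_mat W = 1\<^sub>m k"
    and normW: "\<And>y. y \<in> carrier_vec k \<Longrightarrow> (W *\<^sub>v y) \<bullet> (W *\<^sub>v y) = (\<Sum>i<k. (y $ i)\<^sup>2)"
    and formW: "\<And>y. y \<in> carrier_vec k \<Longrightarrow>
      (W *\<^sub>v y) \<bullet> (B *\<^sub>v (W *\<^sub>v y)) = (\<Sum>i<k. \<beta> ! i * (y $ i)\<^sup>2)"
    using symmetric_principal_axes[OF B specB(3)] by blast
  define CU where "CU = C * U"
  define WTU where "WTU = transpose_mat W * (T * U)"
  have WT: "transpose_mat W \<in> carrier_mat k k" using W by simp
  have CU: "CU \<in> carrier_mat r n" using C U by (simp add: CU_def)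
  have WTU: "WTU \<in> carrier_mat k n" using WT T U unfolding WTU_def by auto
  \<comment> \<open>All conditions are put into one system for the coordinates \<open>y\<close> of
    \<open>x\<close>. The first \<open>r\<close> rows say \<open>C x = 0\<close>, the next
    \<open>p\<close> rows say that \<open>T x\<close> is orthogonal to the first \<open>p\<close>
    eigenvectors of \<open>B\<close>, and each remaining row \<open>i\<close> says that
    \<open>y $ Suc i\<close> vanishes, which confines \<open>x\<close> to the first
    \<open>p + r + 1\<close> eigenvectors of \<open>A\<close>. There are \<open>n - 1\<close>
    equations in \<open>n\<close> unknowns.\<close>
  define M where "M = mat (n - 1) n (\<lambda>(i,j). if i < r then CU $$ (i,j)
    else if i < r + p then WTU $$ (i - r, j) else if j = Suc i then 1 else 0)"
  have M: "M \<in> carrier_mat (n - 1) n" by (simp add: M_def)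
  have "n - 1 < n" using pr by simp
  then obtain y where y: "y \<in> carrier_vec n" "y \<noteq> 0\<^sub>v n" and My: "M *\<^sub>v y = 0\<^sub>v (n - 1)"
    using wide_matrix_kernel[OF M] by blast
  have My_nth: "(\<Sum>j<n. M $$ (i,j) * y $ j) = 0" if "i < n - 1" for i
    using arg_cong[OF My, of "\<lambda>z. z $ i"] that M y
    by (simp add: scalar_prod_def atLeast0LessThan)
  define x where "x = U *\<^sub>v y"
  define z where "z = WTU *\<^sub>v y"
  have x: "x \<in> carrier_vec n" using U y by (simp add: x_def)
  have z: "z \<in> carrier_vec k" using WTU y by (simp add: z_def)
  have "transpose_mat U *\<^sub>v x = y"
    using assoc_mult_mat_vec[of "transpose_mat U" n n U n y] U UU y by (simp add: x_def)
  then have "x \<noteq> 0\<^sub>v n" using y(2) mult_mat_zero_vec[of "transpose_mat U" n n] U by auto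
  moreover have "C *\<^sub>v x = 0\<^sub>v r"
  proof (rule eq_vecI)
    fix i assume "i < dim_vec (0\<^sub>v r)"
    then have i: "i < r" by simp
    have "C *\<^sub>v x = CU *\<^sub>v y" using C U y by (simp add: CU_def x_def)
    then have "(C *\<^sub>v x) $ i = (\<Sum>j<n. M $$ (i,j) * y $ j)"
      using i pr CU y by (simp add: scalar_prod_def atLeast0LessThan M_def)
    then show "(C *\<^sub>v x) $ i = 0\<^sub>v r $ i" using My_nth[of i] i pr by simp
  qed (use C in simp)
  moreover have y_high: "y $ i = 0" if "p + r < i" "i < n" for i
  proof -
    have "(\<Sum>j<n. M $$ (i - 1,j) * y $ j) = (\<Sum>j<n. if j = i then y $ j else 0)"
      using that by (intro sum.cong) (auto simp: M_def)
    then show ?thesis using My_nth[of "i - 1"] that by simp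
  qed
  have z_low: "z $ i = 0" if "i < p" for i
  proof -
    have "z $ i = (\<Sum>j<n. M $$ (r + i,j) * y $ j)"
      using that pr pk WTU y by (simp add: z_def scalar_prod_def atLeast0LessThan M_def)
    then show ?thesis using My_nth[of "r + i"] that pr by simp
  qed
  \<comment> \<open>Only eigenvalues up to index \<open>p + r\<close> contribute, so the Rayleigh
    quotient of \<open>x\<close> is at most \<open>\<alpha> ! (p + r)\<close>.\<close>
  have "x \<bullet> (A *\<^sub>v x) \<le> (\<Sum>i<n. \<alpha> ! (p + r) * (y $ i)\<^sup>2)"
    unfolding x_def formU[OF y(1)]
  proof (rule sum_mono)
    fix i assume "i \<in> {..<n}"
    then have i: "i < n" by simp
    show "\<alpha> ! i * (y $ i)\<^sup>2 \<le> \<alpha> ! (p + r) * (y $ i)\<^sup>2"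
    proof (cases "i \<le> p + r")
      case True
      then have "\<alpha> ! i \<le> \<alpha> ! (p + r)" using specA(1,2) pr by (simp add: sorted_nth_mono)
      then show ?thesis by (simp add: mult_right_mono)
    qed (use y_high i in simp)
  qed
  then have "x \<bullet> (A *\<^sub>v x) \<le> \<alpha> ! (p + r) * (x \<bullet> x)"
    unfolding x_def normU[OF y(1)] by (simp add: sum_distrib_left)
  ultimately have T0: "T *\<^sub>v x \<noteq> 0\<^sub>v k"
    and le: "(T *\<^sub>v x) \<bullet> (B *\<^sub>v (T *\<^sub>v x)) \<le> \<alpha> ! (p + r) * ((T *\<^sub>v x) \<bullet> (T *\<^sub>v x))"
    using comp[OF x] by blast+
  have Tx: "T *\<^sub>v x = W *\<^sub>v z"
  proof -
    have "WTU *\<^sub>v y = transpose_mat W *\<^sub>v (T *\<^sub>v x)"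
      using WT T U y by (simp add: WTU_def x_def assoc_mult_mat_vec[of _ k n _ n] assoc_mult_mat_vec[of _ k k _ n])
    moreover have "W *\<^sub>v (transpose_mat W *\<^sub>v (T *\<^sub>v x)) = T *\<^sub>v x"
      using assoc_mult_mat_vec[of W k k "transpose_mat W" k "T *\<^sub>v x"] W WW T U y by (simp add: x_def)
    ultimately show ?thesis by (simp add: z_def)
  qed
  \<comment> \<open>Dually, the first \<open>p\<close> coordinates of \<open>T x\<close> vanish, so
    its Rayleigh quotient is at least \<open>\<beta> ! p\<close>.\<close>
  have "\<beta> ! p * (\<Sum>i<k. (z $ i)\<^sup>2) \<le> (\<Sum>i<k. \<beta> ! i * (z $ i)\<^sup>2)"
    unfolding sum_distrib_left
  proof (rule sum_mono)
    fix i assume "i \<in> {..<k}"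
    then have i: "i < k" by simp
    show "\<beta> ! p * (z $ i)\<^sup>2 \<le> \<beta> ! i * (z $ i)\<^sup>2"
    proof (cases "p \<le> i")
      case True
      then have "\<beta> ! p \<le> \<beta> ! i" using specB(1,2) i by (simp add: sorted_nth_mono)
      then show ?thesis by (simp add: mult_right_mono)
    qed (use z_low in simp)
  qed
  also have "\<dots> \<le> \<alpha> ! (p + r) * (\<Sum>i<k. (z $ i)\<^sup>2)"
    using le unfolding Tx formW[OF z] normW[OF z] .
  finally have "\<beta> ! p * (\<Sum>i<k. (z $ i)\<^sup>2) \<le> \<alpha> ! (p + r) * (\<Sum>i<k. (z $ i)\<^sup>2)" .
  \<comment> \<open>The condition \<open>T x \<noteq> 0\<close> from \<open>comp\<close> enters
    here: it makes the common factor positive, so it can be cancelled.\<close>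
  moreover have "(\<Sum>i<k. (z $ i)\<^sup>2) > 0"
  proof -
    have "z \<noteq> 0\<^sub>v k" using T0 Tx mult_mat_zero_vec[OF W] by auto
    then obtain i where "i < k" "z $ i \<noteq> 0"
      using z by (metis eq_vecI carrier_vecD index_zero_vec)
    then show ?thesis by (intro sum_pos2[of _ i]) auto
  qed
  ultimately show ?thesis by (rule mult_right_le_imp_le)
qed

section \<open>Laplacian matrices and vectors indexed by vertices\<close>

lemma laplacian_matrix_carrier [simp]:
  "laplacian_matrix G us \<in> carrier_mat (length us) (length us)"
  by (simp add: laplacian_matrix_def degree_matrix_def adjacency_matrix_def minus_carrier_mat)

lemma laplacian_matrix_dim [simp]:
  "dim_row (laplacian_matrix G us) = length us" "dim_col (laplacian_matrix G us) = length us"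
  by (simp_all add: laplacian_matrix_def degree_matrix_def adjacency_matrix_def)

lemma laplacian_matrix_index:
  assumes "i < length us" "j < length us"
  shows "laplacian_matrix G us $$ (i,j) = (if i = j then real (degree_of G (us ! i)) else 0)
    - (if {us ! i, us ! j} \<in> edges G then edge_sign G {us ! i, us ! j} else 0)"
  using assms
  by (auto simp: laplacian_matrix_def degree_matrix_def adjacency_matrix_def mat_diag_def)

lemma laplacian_matrix_symmetric: "transpose_mat (laplacian_matrix G us) = laplacian_matrix G us"
  by (rule eq_matI) (auto simp: laplacian_matrix_index insert_commute)

text \<open>The labellings of the two graphs are unrelated. Viewing vectors as functions on vertices
  lets one function be read in both coordinate systems and turns sums over indices into sums over
  vertices.\<close>

definition labelled_vec :: "'a list \<Rightarrow> ('a \<Rightarrow> real) \<Rightarrow> real vec" where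
  "labelled_vec us f = vec (length us) (\<lambda>i. f (us ! i))"

lemma labelled_vec_carrier [simp]: "labelled_vec us f \<in> carrier_vec (length us)"
  by (simp add: labelled_vec_def)

lemma labelled_vec_cong: "(\<And>a. a \<in> set us \<Longrightarrow> f a = g a) \<Longrightarrow> labelled_vec us f = labelled_vec us g"
  by (auto simp: labelled_vec_def)

lemma labelled_vec_exists:
  assumes "distinct us" "x \<in> carrier_vec (length us)"
  obtains f where "x = labelled_vec us f"
proof
  have "inj_on ((!) us) {..<length us}" using assms by (intro inj_on_nth) auto
  then show "x = labelled_vec us (\<lambda>a. x $ inv_into {..<length us} ((!) us) a)"
    using assms by (intro eq_vecI) (auto simp: labelled_vec_def)
qed

lemma sum_distinct_nth:
  assumes "distinct us"
  shows "(\<Sum>i<length us. g (us ! i)) = sum g (set us)"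
  using sum.reindex_bij_betw[OF bij_betw_nth[OF assms refl refl]] .

lemma labelled_vec_norm:
  assumes "distinct us"
  shows "labelled_vec us f \<bullet> labelled_vec us f = (\<Sum>a\<in>set us. (f a)\<^sup>2)"
  using sum_distinct_nth[OF assms, of "\<lambda>a. (f a)\<^sup>2"]
  by (simp add: labelled_vec_def scalar_prod_def atLeast0LessThan power2_eq_square)

text \<open>The rectangular form covers the Laplacian as well as the extension, restriction and
  evaluation maps between the two vertex sets.\<close>

lemma labelled_vec_mult:
  assumes "distinct ws"
  shows "mat (length us) (length ws) (\<lambda>(i,j). t (us ! i) (ws ! j)) *\<^sub>v labelled_vec ws f
    = labelled_vec us (\<lambda>a. \<Sum>b\<in>set ws. t a b * f b)"
  using sum_distinct_nth[OF assms]
  by (intro eq_vecI) (auto simp: labelled_vec_def scalar_prod_def atLeast0LessThan)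

section \<open>The quadratic form of the Laplacian\<close>

definition laplacian_form :: "'a signed_graph \<Rightarrow> ('a \<Rightarrow> real) \<Rightarrow> real" where
  "laplacian_form G f = (\<Sum>a\<in>vertices G. \<Sum>b\<in>vertices G.
     if {a, b} \<in> edges G then (f a - edge_sign G {a, b} * f b)\<^sup>2 else 0) / 2"

lemma laplacian_form_nonneg: "0 \<le> laplacian_form G f"
  by (auto simp: laplacian_form_def intro!: sum_nonneg)

lemma laplacian_form_cong:
  "(\<And>a. a \<in> vertices G \<Longrightarrow> f a = g a) \<Longrightarrow> laplacian_form G f = laplacian_form G g"
  by (simp add: laplacian_form_def cong: sum.cong if_cong)

text \<open>Edges have exactly two elements, so \<open>b\<close> maps to \<open>{a, b}\<close>
  bijectively from the neighbours of \<open>a\<close> to the edges at \<open>a\<close>. This spreads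
  the diagonal entry over the neighbours.\<close>

lemma degree_of_sum:
  assumes wf: "wf_signed_graph G"
  shows "real (degree_of G a) = (\<Sum>b\<in>vertices G. if {a, b} \<in> edges G then 1 else 0)"
proof -
  have fin: "finite (vertices G)" using wf by (simp add: wf_signed_graph_def)
  have "bij_betw (\<lambda>b. {a, b}) {b \<in> vertices G. {a, b} \<in> edges G} {e \<in> edges G. a \<in> e}"
    unfolding bij_betw_def
  proof
    show "inj_on (\<lambda>b. {a, b}) {b \<in> vertices G. {a, b} \<in> edges G}"
      by (auto simp: inj_on_def doubleton_eq_iff)
    have "e \<in> (\<lambda>b. {a, b}) ` {b \<in> vertices G. {a, b} \<in> edges G}" if "e \<in> edges G" "a \<in> e" for e
    proof -
      have "card e = 2" "e \<subseteq> vertices G" using wf that by (auto simp: wf_signed_graph_def)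
      then obtain b where "e = {a, b}"
        using \<open>a \<in> e\<close> by (metis card_2_iff insertE insert_commute singletonD)
      then show ?thesis using that \<open>e \<subseteq> vertices G\<close> by auto
    qed
    then show "(\<lambda>b. {a, b}) ` {b \<in> vertices G. {a, b} \<in> edges G} = {e \<in> edges G. a \<in> e}" by auto
  qed
  then have "degree_of G a = card {b \<in> vertices G. {a, b} \<in> edges G}"
    unfolding degree_of_def by (simp add: bij_betw_same_card)
  then show ?thesis using fin by (simp add: sum.If_cases Int_def)
qed

text \<open>Each sign squares to 1, so expanding the square of an edge gives both endpoint squares
  minus twice the signed product. Summed over ordered pairs, the endpoint squares give the degree
  term twice.\<close>

lemma laplacian_matrix_form:
  assumes wf: "wf_signed_graph G" and lab: "vertex_labelling G us"
  shows "labelled_vec us f \<bullet> (laplacian_matrix G us *\<^sub>v labelled_vec us f) = laplacian_form G f"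
proof -
  let ?V = "vertices G"
  define s where "s a b = (if {a, b} \<in> edges G then edge_sign G {a, b} else 0)" for a b
  define c where "c a b = (if {a, b} \<in> edges G then 1 else 0 :: real)" for a b
  define t where "t a b = (if a = b then real (degree_of G a) else 0) - s a b" for a b
  have fin: "finite ?V" using wf by (simp add: wf_signed_graph_def)
  have dist: "distinct us" and set: "set us = ?V" using lab by (auto simp: vertex_labelling_def)
  \<comment> \<open>Distinctness of \<open>us\<close> turns the diagonal test on indices into
    equality of vertices.\<close>
  have "laplacian_matrix G us = mat (length us) (length us) (\<lambda>(i,j). t (us ! i) (us ! j))"
    using dist by (intro eq_matI) (auto simp: laplacian_matrix_index t_def s_def nth_eq_iff_index_eq)
  then have "labelled_vec us f \<bullet> (laplacian_matrix G us *\<^sub>v labelled_vec us f)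
      = (\<Sum>i<length us. f (us ! i) * (\<Sum>b\<in>?V. t (us ! i) b * f b))"
    using labelled_vec_mult[OF dist, of us t f]
    by (simp add: set) (simp add: labelled_vec_def scalar_prod_def atLeast0LessThan)
  also have "\<dots> = (\<Sum>a\<in>?V. f a * (\<Sum>b\<in>?V. t a b * f b))"
    using sum_distinct_nth[OF dist, of "\<lambda>a. f a * (\<Sum>b\<in>?V. t a b * f b)"] by (simp add: set)
  also have "\<dots> = (\<Sum>a\<in>?V. \<Sum>b\<in>?V. c a b * (f a)\<^sup>2 - s a b * f a * f b)"
  proof (rule sum.cong[OF refl])
    fix a assume a: "a \<in> ?V"
    have "(\<Sum>b\<in>?V. t a b * f b) = (\<Sum>b\<in>?V. (if a = b then real (degree_of G a) * f b else 0) - s a b * f b)"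
      by (rule sum.cong) (auto simp: t_def algebra_simps)
    also have "\<dots> = (\<Sum>b\<in>?V. c a b) * f a - (\<Sum>b\<in>?V. s a b * f b)"
      using fin a by (simp add: sum_subtractf degree_of_sum[OF wf] c_def)
    finally have "f a * (\<Sum>b\<in>?V. t a b * f b)
        = f a * ((\<Sum>b\<in>?V. c a b) * f a - (\<Sum>b\<in>?V. s a b * f b))" by (simp only:)
    also have "\<dots> = (\<Sum>b\<in>?V. c a b * (f a)\<^sup>2 - s a b * f a * f b)"
      by (simp add: sum_subtractf sum_distrib_left sum_distrib_right algebra_simps power2_eq_square)
    finally show "f a * (\<Sum>b\<in>?V. t a b * f b) = (\<Sum>b\<in>?V. c a b * (f a)\<^sup>2 - s a b * f a * f b)" .
  qed
  also have "\<dots> = (\<Sum>a\<in>?V. \<Sum>b\<in>?V. c a b * (f a)\<^sup>2) - (\<Sum>a\<in>?V. \<Sum>b\<in>?V. s a b * f a * f b)"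
    by (simp add: sum_subtractf)
  also have "\<dots> = laplacian_form G f"
  proof -
    have "(\<Sum>a\<in>?V. \<Sum>b\<in>?V. if {a, b} \<in> edges G then (f a - edge_sign G {a, b} * f b)\<^sup>2 else 0)
      = (\<Sum>a\<in>?V. \<Sum>b\<in>?V. c a b * (f a)\<^sup>2 + c a b * (f b)\<^sup>2 - 2 * (s a b * f a * f b))"
    proof (intro sum.cong refl)
      fix a b
      show "(if {a, b} \<in> edges G then (f a - edge_sign G {a, b} * f b)\<^sup>2 else 0)
        = c a b * (f a)\<^sup>2 + c a b * (f b)\<^sup>2 - 2 * (s a b * f a * f b)"
      proof (cases "{a, b} \<in> edges G")
        case True
        then have "edge_sign G {a, b} \<in> {1, -1}" using wf unfolding wf_signed_graph_def by blast
        then show ?thesis using True by (auto simp: c_def s_def power2_eq_square algebra_simps)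
      qed (simp add: c_def s_def)
    qed
    also have "\<dots> = (\<Sum>a\<in>?V. \<Sum>b\<in>?V. c a b * (f a)\<^sup>2) + (\<Sum>a\<in>?V. \<Sum>b\<in>?V. c a b * (f b)\<^sup>2)
        - 2 * (\<Sum>a\<in>?V. \<Sum>b\<in>?V. s a b * f a * f b)"
      by (simp add: sum_subtractf sum.distrib sum_distrib_left)
    also have "(\<Sum>a\<in>?V. \<Sum>b\<in>?V. c a b * (f b)\<^sup>2) = (\<Sum>a\<in>?V. \<Sum>b\<in>?V. c a b * (f a)\<^sup>2)"
      by (subst sum.swap) (simp add: c_def insert_commute)
    finally show ?thesis by (simp add: laplacian_form_def)
  qed
  finally show ?thesis .
qed

section \<open>Deleting a pendant vertex\<close>

lemma wf_delete_vertex: "wf_signed_graph G \<Longrightarrow> wf_signed_graph (delete_vertex G u)"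
  by (auto simp: wf_signed_graph_def delete_vertex_def)

text \<open>The edge \<open>uv\<close> is the only one at \<open>u\<close>. Its two orientations
  contribute equal squares because the sign squares to 1, and the factor 1/2 leaves one of
  them.\<close>

lemma laplacian_form_pendant:
  assumes wf: "wf_signed_graph G" and deg: "degree_of G u = 1" and uv: "{u, v} \<in> edges G"
  shows "laplacian_form G f =
    laplacian_form (delete_vertex G u) f + (f u - edge_sign G {u, v} * f v)\<^sup>2"
proof -
  define W where "W = vertices G - {u}"
  define s where "s = edge_sign G {u, v}"
  define t where "t a b = (if {a, b} \<in> edges G then (f a - edge_sign G {a, b} * f b)\<^sup>2 else 0)" for a b
  have s: "s \<in> {1, -1}" using wf uv unfolding wf_signed_graph_def s_def by blast
  have fin: "finite W" and uW: "u \<notin> W" using wf by (auto simp: wf_signed_graph_def W_def)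
  have card: "card {u, v} = 2" and sub: "{u, v} \<subseteq> vertices G"
    using wf uv unfolding wf_signed_graph_def by blast+
  then have v: "v \<in> W" by (auto simp: W_def)
  have V: "vertices G = insert u W" using sub by (auto simp: W_def)
  obtain e where "{e \<in> edges G. u \<in> e} = {e}" using deg by (auto simp: degree_of_def card_1_singleton_iff)
  then have nbr: "{u, b} \<in> edges G \<longleftrightarrow> b = v" for b
    using uv by (metis (no_types, lifting) doubleton_eq_iff insertI1 mem_Collect_eq singletonD)
  have tu: "t u b = (if b = v then (f u - s * f v)\<^sup>2 else 0)" for b
    by (simp add: t_def nbr s_def)
  have tu': "t b u = (if b = v then (f v - s * f u)\<^sup>2 else 0)" for b
    using nbr[of b] by (auto simp: t_def s_def insert_commute)
  have "2 * laplacian_form G f = (\<Sum>a\<in>insert u W. \<Sum>b\<in>insert u W. t a b)"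
    unfolding laplacian_form_def t_def V[symmetric] by simp
  \<comment> \<open>The row and the column of \<open>u\<close> each have a single possibly nonzero
    entry, at \<open>v\<close>; the corner \<open>t u u\<close> is zero since \<open>v\<close>
    differs from \<open>u\<close>.\<close>
  also have "\<dots> = (f u - s * f v)\<^sup>2 + (f v - s * f u)\<^sup>2 + (\<Sum>a\<in>W. \<Sum>b\<in>W. t a b)"
    using fin v uW by (simp add: sum.distrib tu tu')
  also have "(f v - s * f u)\<^sup>2 = (f u - s * f v)\<^sup>2"
    using s by (auto simp: power2_eq_square algebra_simps)
  also have "(\<Sum>a\<in>W. \<Sum>b\<in>W. t a b) = 2 * laplacian_form (delete_vertex G u) f"
    by (auto simp: laplacian_form_def delete_vertex_def t_def W_def intro!: sum.cong cong: if_cong split: if_split_asm)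
  finally show ?thesis by (simp add: s_def)
qed

section \<open>The interlacing inequalities\<close>

theorem theorem2p7:
  fixes \<Sigma> \<Sigma>' :: "'a signed_graph"
    and u v :: 'a
    and m :: nat
    and us ws :: "'a list"
    and \<alpha> \<beta> :: "real list"
  assumes "wf_signed_graph \<Sigma>"
    and "card (vertices \<Sigma>) = m + 1"
    and "u \<in> vertices \<Sigma>"
    and "degree_of \<Sigma> u = 1"
    and "{u, v} \<in> edges \<Sigma>"
    and "\<Sigma>' = delete_vertex \<Sigma> u"
    and "vertex_labelling \<Sigma> us"
    and "vertex_labelling \<Sigma>' ws"
    and "\<alpha> = ordered_spectrum (laplacian_matrix \<Sigma> us)"
    and "\<beta> = ordered_spectrum (laplacian_matrix \<Sigma>' ws)"
  shows "length \<alpha> = m + 1 \<and> length \<beta> = m \<and>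
         (\<forall>p\<in>{1..m}. \<alpha> ! (p - 1) \<le> \<beta> ! (p - 1) \<and> \<beta> ! (p - 1) \<le> \<alpha> ! p)"
proof -
  note wf = assms(1) and uv = assms(5)
  let ?L = "laplacian_matrix \<Sigma> us" and ?L' = "laplacian_matrix \<Sigma>' ws"
  define s where "s = edge_sign \<Sigma> {u, v}"
  have wf': "wf_signed_graph \<Sigma>'" using wf_delete_vertex[OF wf] assms(6) by simp
  have us: "distinct us" "set us = vertices \<Sigma>" and ws: "distinct ws" "set ws = vertices \<Sigma> - {u}"
    using assms(6-8) by (auto simp: vertex_labelling_def delete_vertex_def)
  have fin: "finite (vertices \<Sigma>)" using wf by (simp add: wf_signed_graph_def)
  have len: "length us = m + 1" "length ws = m"
    using us ws assms(2,3) fin distinct_card[of us] distinct_card[of ws] by auto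
  have "card {u, v} = 2" and "{u, v} \<subseteq> vertices \<Sigma>"
    using wf uv unfolding wf_signed_graph_def by blast+
  then have "u \<noteq> v" "v \<in> vertices \<Sigma>" by auto
  then have v: "v \<in> set ws" by (simp add: ws(2))
  have set_us: "set us = insert u (set ws)" and u: "u \<notin> set ws" using assms(3) by (auto simp: us(2) ws(2))
  have norm_us: "labelled_vec us f \<bullet> labelled_vec us f = (f u)\<^sup>2 + (\<Sum>a\<in>set ws. (f a)\<^sup>2)" for f
    using u by (simp add: labelled_vec_norm us(1) set_us)
  have norm_ws: "labelled_vec ws f \<bullet> labelled_vec ws f = (\<Sum>a\<in>set ws. (f a)\<^sup>2)" for f
    by (simp add: labelled_vec_norm ws(1))
  have form: "laplacian_form \<Sigma> f = laplacian_form \<Sigma>' f + (f u - s * f v)\<^sup>2" for f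
    unfolding s_def assms(6) by (rule laplacian_form_pendant[OF wf assms(4) uv])
  have form_us: "labelled_vec us f \<bullet> (?L *\<^sub>v labelled_vec us f) = laplacian_form \<Sigma> f" for f
    by (rule laplacian_matrix_form[OF wf assms(7)])
  have form_ws: "labelled_vec ws f \<bullet> (?L' *\<^sub>v labelled_vec ws f) = laplacian_form \<Sigma>' f" for f
    by (rule laplacian_matrix_form[OF wf' assms(8)])
  have L: "?L \<in> carrier_mat (m + 1) (m + 1)" "transpose_mat ?L = ?L"
    and L': "?L' \<in> carrier_mat m m" "transpose_mat ?L' = ?L'"
    using laplacian_matrix_carrier[of \<Sigma> us] laplacian_matrix_carrier[of \<Sigma>' ws] len
    by (auto simp: laplacian_matrix_symmetric)
  have pos: "x \<bullet> x > 0" if "x \<in> carrier_vec n" "x \<noteq> 0\<^sub>v n" for x :: "real vec" and n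
    using conjugate_square_greater_0_vec[OF that(1)] that(2) by simp
  have lower: "\<alpha> ! p \<le> \<beta> ! p" if p: "p < m" for p
  proof -
    \<comment> \<open>Kernel of the extension map: it copies the values on the remaining vertices
      and assigns to \<open>u\<close> the value \<open>s * f v\<close>, for which the pendant term
      vanishes. No equations are imposed, so \<open>C\<close> has 0 rows and the index shift is
      \<open>p + 0\<close>.\<close>
    define t where "t a b = (if a = u then if b = v then s else 0 else if b = a then 1 else 0)" for a b
    define T where "T = mat (m + 1) m (\<lambda>(i,j). t (us ! i) (ws ! j))"
    have "\<alpha> ! p \<le> \<beta> ! (p + 0)"
      unfolding assms(9,10)
    proof (rule spectrum_comparison[OF L' L zero_carrier_mat[of 0 m], where T = T])
      show "T \<in> carrier_mat (m + 1) m" by (simp add: T_def)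
      fix x :: "real vec"
      let ?c = "ordered_spectrum ?L' ! (p + 0)"
      assume x: "x \<in> carrier_vec m" "x \<noteq> 0\<^sub>v m" and le: "x \<bullet> (?L' *\<^sub>v x) \<le> ?c * (x \<bullet> x)"
      obtain f where f: "x = labelled_vec ws f"
        using labelled_vec_exists[OF ws(1)] x(1) len by metis
      define g where "g = f(u := s * f v)"
      have "T *\<^sub>v x = labelled_vec us (\<lambda>a. \<Sum>b\<in>set ws. t a b * f b)"
        unfolding T_def f using labelled_vec_mult[OF ws(1), of us t f] len by simp
      also have "\<dots> = labelled_vec us g"
      proof (rule labelled_vec_cong)
        fix a assume a: "a \<in> set us"
        have "(\<Sum>b\<in>set ws. t a b * f b) = (\<Sum>b\<in>set ws. if b = (if a = u then v else a) then g a else 0)"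
          by (rule sum.cong) (auto simp: t_def g_def)
        then show "(\<Sum>b\<in>set ws. t a b * f b) = g a" using a v by (auto simp: set_us)
      qed
      finally have Tx: "T *\<^sub>v x = labelled_vec us g" .
      have Sf: "(\<Sum>a\<in>set ws. (f a)\<^sup>2) > 0" using pos[OF x] by (simp add: f norm_ws)
      have Sg: "(\<Sum>a\<in>set ws. (g a)\<^sup>2) = (\<Sum>a\<in>set ws. (f a)\<^sup>2)"
        using u by (intro sum.cong) (auto simp: g_def)
      have le': "laplacian_form \<Sigma>' f \<le> ?c * (\<Sum>a\<in>set ws. (f a)\<^sup>2)"
        using le by (simp only: f norm_ws form_ws)
      \<comment> \<open>The extension enlarges the norm by the square of \<open>g u\<close>, so the
        bound survives only for a nonnegative \<open>?c\<close>; this follows from the form being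
        nonnegative and the norm positive.\<close>
      then have "0 \<le> ?c * (\<Sum>a\<in>set ws. (f a)\<^sup>2)" using laplacian_form_nonneg order_trans by blast
      then have c: "0 \<le> ?c" using Sf by (simp add: zero_le_mult_iff)
      have "laplacian_form \<Sigma> g = laplacian_form \<Sigma>' g"
        unfolding form using v u by (auto simp: g_def)
      also have "\<dots> = laplacian_form \<Sigma>' f"
        by (rule laplacian_form_cong) (auto simp: g_def assms(6) delete_vertex_def)
      also have "\<dots> \<le> ?c * ((g u)\<^sup>2 + (\<Sum>a\<in>set ws. (g a)\<^sup>2))"
        using le' c by (simp add: Sg distrib_left add_increasing)
      finally have "(T *\<^sub>v x) \<bullet> (?L *\<^sub>v (T *\<^sub>v x)) \<le> ?c * ((T *\<^sub>v x) \<bullet> (T *\<^sub>v x))"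
        by (simp only: Tx form_us norm_us)
      moreover have "(T *\<^sub>v x) \<bullet> (T *\<^sub>v x) > 0"
        unfolding Tx norm_us Sg using Sf by (simp add: add_nonneg_pos)
      then have "T *\<^sub>v x \<noteq> 0\<^sub>v (m + 1)" by auto
      ultimately show "T *\<^sub>v x \<noteq> 0\<^sub>v (m + 1) \<and>
        (T *\<^sub>v x) \<bullet> (?L *\<^sub>v (T *\<^sub>v x)) \<le> ?c * ((T *\<^sub>v x) \<bullet> (T *\<^sub>v x))" by blast
    qed (use p in auto)
    then show ?thesis by simp
  qed
  have upper: "\<beta> ! p \<le> \<alpha> ! (p + 1)" if p: "p < m" for p
  proof -
    \<comment> \<open>With the identity kernel, \<open>T\<close> restricts a function to the
      remaining vertices and \<open>C\<close> evaluates it at \<open>u\<close>. The single equation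
      \<open>f u = 0\<close> accounts for the index shift by 1.\<close>
    define t where "t a b = (if b = a then 1 else 0 :: real)" for a b :: 'a
    define T where "T = mat m (m + 1) (\<lambda>(i,j). t (ws ! i) (us ! j))"
    define C where "C = mat 1 (m + 1) (\<lambda>(i,j). t ([u] ! i) (us ! j))"
    show ?thesis
      unfolding assms(9,10)
    proof (rule spectrum_comparison[OF L L', where T = T and C = C])
      show "T \<in> carrier_mat m (m + 1)" "C \<in> carrier_mat 1 (m + 1)" by (auto simp: T_def C_def)
      fix x :: "real vec"
      let ?c = "ordered_spectrum ?L ! (p + 1)"
      assume x: "x \<in> carrier_vec (m + 1)" "x \<noteq> 0\<^sub>v (m + 1)" and Cx: "C *\<^sub>v x = 0\<^sub>v 1"
        and le: "x \<bullet> (?L *\<^sub>v x) \<le> ?c * (x \<bullet> x)"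
      obtain f where f: "x = labelled_vec us f"
        using labelled_vec_exists[OF us(1)] x(1) len by metis
      have sel: "labelled_vec vs (\<lambda>a. \<Sum>b\<in>set us. t a b * f b) = labelled_vec vs f"
        if "set vs \<subseteq> set us" for vs
      proof (rule labelled_vec_cong)
        fix a assume a: "a \<in> set vs"
        have "(\<Sum>b\<in>set us. t a b * f b) = (\<Sum>b\<in>set us. if b = a then f a else 0)"
          by (rule sum.cong) (auto simp: t_def)
        then show "(\<Sum>b\<in>set us. t a b * f b) = f a" using a that by auto
      qed
      have "C *\<^sub>v x = labelled_vec [u] f"
        unfolding C_def f using labelled_vec_mult[OF us(1), of "[u]" t f] len sel[of "[u]"] us assms(3)
        by simp
      then have fu: "f u = 0"
        using arg_cong[OF Cx, of "\<lambda>z. z $ 0"] by (simp add: labelled_vec_def)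
      have Tx: "T *\<^sub>v x = labelled_vec ws f"
        unfolding T_def f using labelled_vec_mult[OF us(1), of ws t f] len sel[of ws] set_us by auto
      have S: "(\<Sum>a\<in>set ws. (f a)\<^sup>2) > 0" using pos[OF x] by (simp add: f norm_us fu)
      \<comment> \<open>Restriction drops a square from the form, while the norm is unchanged
        because \<open>f u = 0\<close>.\<close>
      have "laplacian_form \<Sigma>' f \<le> laplacian_form \<Sigma> f" by (simp add: form)
      also have "\<dots> \<le> ?c * (\<Sum>a\<in>set ws. (f a)\<^sup>2)"
        using le unfolding f norm_us form_us fu by simp
      finally have "(T *\<^sub>v x) \<bullet> (?L' *\<^sub>v (T *\<^sub>v x)) \<le> ?c * ((T *\<^sub>v x) \<bullet> (T *\<^sub>v x))"
        by (simp only: Tx form_ws norm_ws)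
      moreover have "(T *\<^sub>v x) \<bullet> (T *\<^sub>v x) > 0" unfolding Tx norm_ws by (rule S)
      then have "T *\<^sub>v x \<noteq> 0\<^sub>v m" by auto
      ultimately show "T *\<^sub>v x \<noteq> 0\<^sub>v m \<and>
        (T *\<^sub>v x) \<bullet> (?L' *\<^sub>v (T *\<^sub>v x)) \<le> ?c * ((T *\<^sub>v x) \<bullet> (T *\<^sub>v x))" by blast
    qed (use p in auto)
  qed
  show ?thesis
  proof (intro conjI ballI)
    show "length \<alpha> = m + 1" "length \<beta> = m"
      using ordered_spectrum_symmetric(1)[OF L] ordered_spectrum_symmetric(1)[OF L'] assms(9,10)
      by simp_all
    \<comment> \<open>The claim counts from 1 and the lists from 0, so both bounds are taken at
      \<open>p - 1\<close>.\<close>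
    fix p assume "p \<in> {1..m}"
    then show "\<alpha> ! (p - 1) \<le> \<beta> ! (p - 1)" "\<beta> ! (p - 1) \<le> \<alpha> ! p"
      using lower[of "p - 1"] upper[of "p - 1"] by auto
  qed
qed

end
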